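(* Let $u,v,w\in\mathcal{H}$ be the vertices of a triangle in the hyperbolic plane $\mathcal{H}$. Let $L$, $M$, $N$ be the sides opposite to $u$, $v$, $w$ respectively, and let $\ell, m, n\in\mathcal{F}$ be cycles defining $L, M, N$. Put $$A(u)=\langle n,\ell\rangle\, m-\langle m,\ell\rangle\, n,\qquad A(v)=\langle \ell,m\rangle\, n-\langle n,m\rangle\,\ell,$$ and let $$\Delta=\det\begin{pmatrix}\langle A(u),A(u)\rangle & \langle A(u),A(v)\rangle\\ \langle A(u),A(v)\rangle & \langle A(v),A(v)\rangle\end{pmatrix},$$ a number that depends only on $\ell,m,n$. Then: (1) $\Delta>0$ if and only if the three altitudes of the triangle intersect in a common point of $\mathcal{H}$. (2) $\Delta=0$ if and only if the three altitudes are asymptotically parallel, i.e. have a common point on the boundary at infinity of $\mathcal{H}$. (3) $\Delta<0$ if and only if there is a unique hyperbolic line orthogonal to all three altitudes.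
   Context: Let $\mathcal{F}$ be the real $4$-dimensional vector space of all functions $f:\mathbb{R}^2\to\mathbb{R}$ of the form $f(X)=a\,X\cdot X+b\cdot X+c$ with $a,c\in\mathbb{R}$, $b\in\mathbb{R}^2$, where $\cdot$ is the standard dot product; nonzero elements of $\mathcal{F}$ are called cycles. The cycle pairing is the symmetric bilinear form on $\mathcal{F}$ given by $\langle f,f^*\rangle=b\cdot b^*-2ac^*-2a^*c$ for $f=aX\cdot X+b\cdot X+c$, $f^*=a^*X\cdot X+b^*\cdot X+c^*$. The hyperbolic plane is the upper half plane $\mathcal{H}=\{(x,y)\in\mathbb{R}^2: y>0\}$. A hyperbolic line is the part lying in $\mathcal{H}$ of a Euclidean line or of a Euclidean circle of positive radius in $\mathbb{R}^2$ that is orthogonal to the $x$-axis (i.e. the upper half of a vertical line, or the upper semicircle of a circle centered on the $x$-axis). A cycle defines a hyperbolic line if its zero set in $\mathbb{R}^2$ is the corresponding Euclidean line or circle; such a cycle is determined up to a nonzero scalar factor. Two hyperbolic lines are orthogonal if the corresponding Euclidean lines or circles are orthogonal in the classical Euclidean sense. The boundary at infinity of $\mathcal{H}$ is the $x$-axis $\{(x,0)\}$ together with one extra point $\infty$; a point $(x,0)$ lies on a hyperbolic line if it lies on the corresponding Euclidean line or circle, and $\infty$ lies exactly on the hyperbolic lines that are upper halves of vertical lines. A triangle is given by three points of $\mathcal{H}$ not on a common hyperbolic line; its sides are the three hyperbolic lines through pairs of vertices. The altitude through a vertex is the (unique) hyperbolic line passing through that vertex and orthogonal to the opposite side. *)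

theory Defs
  imports "HOL-Analysis.Analysis"
begin

definition quad_fun :: "real \<Rightarrow> real^2 \<Rightarrow> real \<Rightarrow> (real^2 \<Rightarrow> real)" where
  "quad_fun a b c = (\<lambda>X. a * (X \<bullet> X) + b \<bullet> X + c)"

definition quad_space :: "(real^2 \<Rightarrow> real) set" where
  "quad_space = {f. \<exists>a b c. f = quad_fun a b c}"

definition is_cycle :: "(real^2 \<Rightarrow> real) \<Rightarrow> bool" where
  "is_cycle f \<longleftrightarrow> f \<in> quad_space \<and> f \<noteq> (\<lambda>X. 0)"

lemma quad_fun_inject:
  "quad_fun a b c = quad_fun a' b' c' \<longleftrightarrow> a = a' \<and> b = b' \<and> c = c'"
proof
  assume eq: "quad_fun a b c = quad_fun a' b' c'"
  have *: "a * (X \<bullet> X) + b \<bullet> X + c = a' * (X \<bullet> X) + b' \<bullet> X + c'" for X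
    using fun_cong[OF eq, of X] by (simp add: quad_fun_def)
  have c: "c = c'" using *[of 0] by simp
  have a: "a = a'" using *[of "axis 1 1"] *[of "- axis 1 1"] c by (simp add: inner_axis_axis)
  have "b \<bullet> X = b' \<bullet> X" for X using *[of X] a c by simp
  then have "b = b'" by (metis vector_eq_ldot inner_commute)
  with a c show "a = a' \<and> b = b' \<and> c = c'" by simp
qed simp

text \<open>Well defined on \<^const>\<open>quad_space\<close> because the coefficients of a function are unique.\<close>

definition cycle_pairing :: "(real^2 \<Rightarrow> real) \<Rightarrow> (real^2 \<Rightarrow> real) \<Rightarrow> real" where
  "cycle_pairing f g = (THE r. \<exists>a b c a' b' c'. f = quad_fun a b c \<and> g = quad_fun a' b' c' \<and>
      r = b \<bullet> b' - 2 * a * c' - 2 * a' * c)"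

lemma cycle_pairing_quad_fun:
  "cycle_pairing (quad_fun a b c) (quad_fun a' b' c') = b \<bullet> b' - 2 * a * c' - 2 * a' * c"
  unfolding cycle_pairing_def by (rule the_equality) (auto simp: quad_fun_inject)

definition half_plane :: "(real^2) set" where
  "half_plane = {X. X $ 2 > 0}"

definition x_axis :: "(real^2) set" where
  "x_axis = {X. X $ 2 = 0}"

definition euclid_line :: "(real^2) set \<Rightarrow> bool" where
  "euclid_line S \<longleftrightarrow> (\<exists>p d. d \<noteq> 0 \<and> S = range (\<lambda>s. p + s *\<^sub>R d))"

definition euclid_circle :: "(real^2) set \<Rightarrow> bool" where
  "euclid_circle S \<longleftrightarrow> (\<exists>z r. r > 0 \<and> S = sphere z r)"

definition tangent_vectors :: "(real^2) set \<Rightarrow> real^2 \<Rightarrow> (real^2) set" where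
  "tangent_vectors S P = {t.
      (\<exists>p d. d \<noteq> 0 \<and> S = range (\<lambda>s. p + s *\<^sub>R d) \<and> P \<in> S \<and> t \<in> span {d}) \<or>
      (\<exists>z r. r > 0 \<and> S = sphere z r \<and> P \<in> S \<and> t \<bullet> (P - z) = 0)}"

definition euclid_orthogonal :: "(real^2) set \<Rightarrow> (real^2) set \<Rightarrow> bool" where
  "euclid_orthogonal S T \<longleftrightarrow>
     (euclid_line S \<or> euclid_circle S) \<and> (euclid_line T \<or> euclid_circle T) \<and>
     S \<inter> T \<noteq> {} \<and>
     (\<forall>P \<in> S \<inter> T. \<forall>s \<in> tangent_vectors S P. \<forall>t \<in> tangent_vectors T P. s \<bullet> t = 0)"

text \<open>\<open>carrier_of L C\<close>: \<open>C\<close> is the Euclidean line or circle corresponding to the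
  hyperbolic line \<open>L\<close>.\<close>

definition carrier_of :: "(real^2) set \<Rightarrow> (real^2) set \<Rightarrow> bool" where
  "carrier_of L C \<longleftrightarrow>
     euclid_orthogonal C x_axis \<and> L = C \<inter> half_plane"

definition hyp_line :: "(real^2) set \<Rightarrow> bool" where
  "hyp_line L \<longleftrightarrow> (\<exists>C. carrier_of L C)"

definition defines_line :: "(real^2 \<Rightarrow> real) \<Rightarrow> (real^2) set \<Rightarrow> bool" where
  "defines_line f L \<longleftrightarrow> is_cycle f \<and> carrier_of L {X. f X = 0}"

definition hyp_orthogonal :: "(real^2) set \<Rightarrow> (real^2) set \<Rightarrow> bool" where
  "hyp_orthogonal L M \<longleftrightarrow> (\<exists>C D. carrier_of L C \<and> carrier_of M D \<and> euclid_orthogonal C D)"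

datatype boundary_point = Axis_Point real | Infinity_Point

fun boundary_on :: "boundary_point \<Rightarrow> (real^2) set \<Rightarrow> bool" where
  "boundary_on (Axis_Point x) L \<longleftrightarrow> (\<exists>C. carrier_of L C \<and> vector [x, 0] \<in> C)"
| "boundary_on Infinity_Point L \<longleftrightarrow> (\<exists>x. L = {X. X $ 1 = x} \<inter> half_plane)"

definition hyp_triangle :: "real^2 \<Rightarrow> real^2 \<Rightarrow> real^2 \<Rightarrow> bool" where
  "hyp_triangle u v w \<longleftrightarrow> u \<in> half_plane \<and> v \<in> half_plane \<and> w \<in> half_plane \<and>
     \<not> (\<exists>L. hyp_line L \<and> u \<in> L \<and> v \<in> L \<and> w \<in> L)"

definition line_through :: "real^2 \<Rightarrow> real^2 \<Rightarrow> (real^2) set" where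
  "line_through p q = (THE L. hyp_line L \<and> p \<in> L \<and> q \<in> L)"

text \<open>The altitude through the vertex \<open>u\<close>, where \<open>L\<close> is the opposite side.\<close>

definition altitude :: "real^2 \<Rightarrow> (real^2) set \<Rightarrow> (real^2) set" where
  "altitude u L = (THE K. hyp_line K \<and> u \<in> K \<and> hyp_orthogonal K L)"

end

theory Submission imports Defs "HOL-Library.Quadratic_Discriminant" begin

text \<open>
  A cycle \<open>a X \<cdot> X + b x + c\<close> whose zero set is orthogonal to the \<open>x\<close>-axis is a vector
  \<open>p = (a, b, c)\<close> of a three-dimensional space on which the pairing has signature \<open>(2, 1)\<close>, and it
  vanishes at \<open>X\<close> iff \<open>p\<close> is perpendicular, for the dot product, to \<open>(X \<cdot> X, x, 1)\<close>. Hyperbolic lines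
  are the spacelike vectors up to scaling, and orthogonality of lines is vanishing of the pairing.
  Since \<open>A(u)\<close> vanishes at \<open>u\<close> and is orthogonal to \<open>\<ell>\<close>, it defines the altitude through \<open>u\<close>, and
  cyclically; moreover \<open>A(u) + A(v) + A(w) = 0\<close>, so only \<open>A(u)\<close> and \<open>A(v)\<close> matter, and these are
  linearly independent. Their Gram determinant is \<open>4 (r\<^sub>1 r\<^sub>3 - r\<^sub>2\<^sup>2)\<close> for the cross product
  \<open>r = A(u) \<times> A(v)\<close>. It is positive iff \<open>r\<close> is proportional to \<open>(X \<cdot> X, x, 1)\<close> for some \<open>X\<close> in the
  half plane, zero iff \<open>r\<close> is proportional to \<open>(x\<^sup>2, x, 1)\<close> or \<open>(1, 0, 0)\<close>, a common point at infinity,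
  and negative iff the vector dual to \<open>r\<close> is spacelike, defining the common perpendicular.
\<close>

unbundle cross3_syntax

section \<open>Cycles orthogonal to the axis as vectors of three-space\<close>

lemma inner_2: "x \<bullet> y = x$1 * y$1 + x$2 * y$2" for x y :: "real^2"
  by (simp add: inner_vec_def sum_2)

lemma inner_3: "x \<bullet> y = x$1 * y$1 + x$2 * y$2 + x$3 * y$3" for x y :: "real^3"
  by (simp add: inner_vec_def sum_3)

lemma vec_eq_2: "x = y \<longleftrightarrow> x$1 = y$1 \<and> x$2 = y$2" for x y :: "real^2"
  by (simp add: vec_eq_iff forall_2)

lemma vec_eq_3: "x = y \<longleftrightarrow> x$1 = y$1 \<and> x$2 = y$2 \<and> x$3 = y$3" for x y :: "real^3"
  by (simp add: vec_eq_iff forall_3)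

text \<open>The point of the paraboloid-like model dual to the coefficients
  \<open>(a, b, c)\<close>. Mirror points in the axis have the same lift, matching the symmetry of
  these cycles.\<close>

definition lift :: "real^2 \<Rightarrow> real^3" where
  "lift X = vector [(X$1)\<^sup>2 + (X$2)\<^sup>2, X$1, 1]"

lemma lift_nth [simp]:
  "lift X $ 1 = (X$1)\<^sup>2 + (X$2)\<^sup>2" "lift X $ 2 = X$1" "lift X $ 3 = 1"
  by (simp_all add: lift_def)

definition axis_cycle :: "real^3 \<Rightarrow> real^2 \<Rightarrow> real" where
  "axis_cycle p = quad_fun (p$1) (vector [p$2, 0]) (p$3)"

lemma axis_cycle_eq_inner: "axis_cycle p X = p \<bullet> lift X"
  by (simp add: axis_cycle_def quad_fun_def inner_2 inner_3 power2_eq_square)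

definition pairing :: "real^3 \<Rightarrow> real^3 \<Rightarrow> real" where
  "pairing p q = p$2 * q$2 - 2 * p$1 * q$3 - 2 * q$1 * p$3"

lemma cycle_pairing_axis_cycle: "cycle_pairing (axis_cycle p) (axis_cycle q) = pairing p q"
  by (simp add: axis_cycle_def cycle_pairing_quad_fun pairing_def inner_2)

lemma pairing_commute: "pairing p q = pairing q p"
  by (simp add: pairing_def)

lemma pairing_simps [simp]:
  "pairing (p + q) r = pairing p r + pairing q r"
  "pairing (p - q) r = pairing p r - pairing q r"
  "pairing (k *\<^sub>R p) r = k * pairing p r"
  "pairing (- p) r = - pairing p r"
  "pairing r (p + q) = pairing r p + pairing r q"
  "pairing r (p - q) = pairing r p - pairing r q"
  "pairing r (k *\<^sub>R p) = k * pairing r p"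
  "pairing r (- p) = - pairing r p"
  by (simp_all add: pairing_def algebra_simps)

text \<open>The matrix of the pairing. It turns conditions on the pairing into perpendicularity for
  the dot product, which the cross product can solve.\<close>

definition polar :: "real^3 \<Rightarrow> real^3" where
  "polar p = vector [- 2 * p$3, p$2, - 2 * p$1]"

lemma polar_nth [simp]: "polar p $ 1 = - 2 * p$3" "polar p $ 2 = p$2" "polar p $ 3 = - 2 * p$1"
  by (simp_all add: polar_def)

lemma pairing_eq_inner_polar: "pairing p q = p \<bullet> polar q"
  by (simp add: pairing_def inner_3)

section \<open>Vectors perpendicular to two independent vectors\<close>

lemma cross_eq_zero_imp_scaled:
  fixes p q :: "real^3"
  assumes "p \<times> q = 0" "q \<noteq> 0"
  shows "\<exists>k. p = k *\<^sub>R q"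
proof -
  have "q \<times> (p \<times> q) = (q \<bullet> q) *\<^sub>R p - (q \<bullet> p) *\<^sub>R q"
    by (rule Lagrange)
  with assms have "(q \<bullet> q) *\<^sub>R p = (q \<bullet> p) *\<^sub>R q"
    by simp
  then have "p = ((q \<bullet> p) / (q \<bullet> q)) *\<^sub>R q"
    using assms(2)
    by (metis divide_inverse_commute eq_vector_fraction_iff inner_eq_zero_iff scaleR_scaleR)
  then show ?thesis ..
qed

lemma orthogonal_both_imp_scaled_cross:
  fixes p q x :: "real^3"
  assumes "p \<times> q \<noteq> 0" "x \<bullet> p = 0" "x \<bullet> q = 0"
  shows "\<exists>k. x = k *\<^sub>R (p \<times> q)"
proof (rule cross_eq_zero_imp_scaled)
  show "x \<times> (p \<times> q) = 0"
    using assms by (simp add: Lagrange)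
qed fact

text \<open>The common source of two uniqueness facts below: for the line through two points and for
  the perpendicular through a point.\<close>

lemma orthogonal_both_unique:
  fixes p q x y :: "real^3"
  assumes "p \<times> q \<noteq> 0" "x \<bullet> p = 0" "x \<bullet> q = 0" "y \<bullet> p = 0" "y \<bullet> q = 0" "x \<noteq> 0"
  shows "\<exists>k. y = k *\<^sub>R x"
proof -
  obtain i j where "x = i *\<^sub>R (p \<times> q)" "y = j *\<^sub>R (p \<times> q)"
    using orthogonal_both_imp_scaled_cross[OF assms(1)] assms(2-5) by metis
  then have "y = (j / i) *\<^sub>R x"
    using assms(6) by auto
  then show ?thesis ..
qed

lemma lift_nonzero: "lift X \<noteq> 0"
  by (metis lift_nth(3) zero_index zero_neq_one)

text \<open>Third coordinates are 1, so parallel lifts are equal. A lift determines \<open>x\<close>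
  and \<open>y^2\<close>, and \<open>y > 0\<close> fixes the sign.\<close>

lemma lift_cross_nonzero:
  assumes "X \<in> half_plane" "Y \<in> half_plane" "X \<noteq> Y"
  shows "lift X \<times> lift Y \<noteq> 0"
proof
  assume "lift X \<times> lift Y = 0"
  then have "(lift X \<times> lift Y) $ 1 = 0" "(lift X \<times> lift Y) $ 2 = 0"
    by simp_all
  then have "X$1 = Y$1" "(X$2)\<^sup>2 = (Y$2)\<^sup>2"
    unfolding cross_components by auto
  moreover have "X$2 > 0" "Y$2 > 0"
    using assms by (auto simp: half_plane_def)
  ultimately have "X = Y"
    by (simp add: vec_eq_2)
  with assms show False by simp
qed

text \<open>Completing the square: \<open>\<langle>p,p\<rangle> = (2 a x + b)\<^sup>2 + (2 a y)\<^sup>2\<close> at every zero \<open>(x, y)\<close> of the cycle,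
  so a cycle vanishing somewhere in the half plane is spacelike.\<close>

lemma pairing_self_at_zero:
  assumes "p \<bullet> lift X = 0"
  shows "pairing p p = (2 * p$1 * X$1 + p$2)\<^sup>2 + (2 * p$1 * X$2)\<^sup>2"
proof -
  have p3: "p$3 = - (p$1 * ((X$1)\<^sup>2 + (X$2)\<^sup>2) + p$2 * X$1)"
    using assms by (simp add: inner_3)
  show ?thesis
    unfolding pairing_def p3 by (simp add: power2_eq_square algebra_simps)
qed

lemma spacelike_if_vanishes:
  assumes "X \<in> half_plane" "p \<bullet> lift X = 0" "p \<noteq> 0"
  shows "pairing p p > 0"
proof (rule ccontr)
  assume "\<not> pairing p p > 0"
  then have "2 * p$1 * X$1 + p$2 = 0" "2 * p$1 * X$2 = 0"
    unfolding pairing_self_at_zero[OF assms(2)] using sum_power2_gt_zero_iff by blast+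
  then have "p$1 = 0" "p$2 = 0"
    using assms(1) by (auto simp: half_plane_def)
  then have "p = 0"
    using assms(2) by (simp add: inner_3 vec_eq_3)
  with assms(3) show False ..
qed

text \<open>A vector whose polar is proportional to a lift pairs with itself to minus a square, so
  it is not spacelike.\<close>

lemma lift_cross_polar_nonzero:
  assumes "pairing p p > 0"
  shows "lift X \<times> polar p \<noteq> 0"
proof
  assume "lift X \<times> polar p = 0"
  then have "polar p \<times> lift X = 0"
    by (subst cross_skew) simp
  then obtain k where "polar p = k *\<^sub>R lift X"
    using cross_eq_zero_imp_scaled lift_nonzero by blast
  then have "- 2 * p$3 = k * ((X$1)\<^sup>2 + (X$2)\<^sup>2)" "p$2 = k * X$1" "- 2 * p$1 = k"
    by (simp_all add: vec_eq_3)
  then have *: "p$2 = k * X$1" "p$1 = - k / 2" "p$3 = - k * ((X$1)\<^sup>2 + (X$2)\<^sup>2) / 2"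
    by simp_all
  have "pairing p p = - (k * X$2)\<^sup>2"
    unfolding pairing_def * by (simp add: power2_eq_square algebra_simps)
  with assms show False
    by (smt (verit) zero_le_power2)
qed

section \<open>The Gram determinant and common zeros\<close>

text \<open>The analogue for this pairing of Lagrange's identity for the squared length of a cross
  product.\<close>

lemma gram_eq_cross:
  "pairing p p * pairing q q - (pairing p q)\<^sup>2 =
    4 * ((p \<times> q) $ 1 * (p \<times> q) $ 3 - ((p \<times> q) $ 2)\<^sup>2)"
  by (simp add: pairing_def cross_components power2_eq_square algebra_simps)

lemma common_point_iff_gram_pos:
  assumes "p \<times> q \<noteq> 0"
  shows "(\<exists>X\<in>half_plane. p \<bullet> lift X = 0 \<and> q \<bullet> lift X = 0) \<longleftrightarrow>
    pairing p p * pairing q q - (pairing p q)\<^sup>2 > 0"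
proof
  assume "\<exists>X\<in>half_plane. p \<bullet> lift X = 0 \<and> q \<bullet> lift X = 0"
  then obtain X where X: "X \<in> half_plane" "lift X \<bullet> p = 0" "lift X \<bullet> q = 0"
    by (auto simp: inner_commute)
  then obtain k where k: "lift X = k *\<^sub>R (p \<times> q)"
    using orthogonal_both_imp_scaled_cross[OF assms] by blast
  let ?r = "p \<times> q"
  have r: "(X$1)\<^sup>2 + (X$2)\<^sup>2 = k * ?r$1" "X$1 = k * ?r$2" "1 = k * ?r$3"
    using arg_cong[OF k, of "\<lambda>x. x$1"] arg_cong[OF k, of "\<lambda>x. x$2"] arg_cong[OF k, of "\<lambda>x. x$3"]
    by simp_all
  \<comment> \<open>Rescaling by \<open>k\<close> turns \<open>?r\<close> into the lift of
    \<open>X\<close>, on which the quadratic form takes the value \<open>(X$2)^2\<close>.\<close>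
  have "k\<^sup>2 * (?r$1 * ?r$3 - (?r$2)\<^sup>2) = (k * ?r$1) * (k * ?r$3) - (k * ?r$2)\<^sup>2"
    by (simp add: power2_eq_square algebra_simps)
  also have "\<dots> = (X$2)\<^sup>2"
    unfolding r[symmetric] by simp
  also have "\<dots> > 0"
    using X(1) by (simp add: half_plane_def)
  finally show "pairing p p * pairing q q - (pairing p q)\<^sup>2 > 0"
    unfolding gram_eq_cross by (simp add: zero_less_mult_iff)
next
  let ?r = "p \<times> q"
  assume "pairing p p * pairing q q - (pairing p q)\<^sup>2 > 0"
  then have gram: "?r$1 * ?r$3 - (?r$2)\<^sup>2 > 0"
    by (simp add: gram_eq_cross)
  then have r3: "?r$3 \<noteq> 0"
    using zero_le_power2[of "?r$2"] by force
  \<comment> \<open>Solves \<open>lift X = ?r / ?r$3\<close> for \<open>X\<close>; the absolute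
    value selects the root in the upper half plane.\<close>
  define X :: "real^2" where "X = vector [?r$2 / ?r$3, sqrt (?r$1 * ?r$3 - (?r$2)\<^sup>2) / \<bar>?r$3\<bar>]"
  have "lift X = (1 / ?r$3) *\<^sub>R ?r"
    using r3 gram by (simp add: vec_eq_3 X_def power_divide) (simp add: field_simps power2_eq_square)
  then have "p \<bullet> lift X = 0 \<and> q \<bullet> lift X = 0"
    by (simp add: dot_cross_self)
  moreover have "X \<in> half_plane"
    using r3 gram by (simp add: half_plane_def X_def)
  ultimately show "\<exists>X\<in>half_plane. p \<bullet> lift X = 0 \<and> q \<bullet> lift X = 0"
    by blast
qed

section \<open>Euclidean lines, circles and their tangents\<close>

text \<open>\<open>tangent_vectors\<close> ranges over all descriptions of a set as a line or a
  circle. This lemma and the next two show that the tangents do not depend on the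
  description.\<close>

lemma line_eq_imp_span_eq:
  fixes d d' :: "'a::real_vector"
  assumes "range (\<lambda>s. p + s *\<^sub>R d) = range (\<lambda>s. p' + s *\<^sub>R d')"
  shows "d \<in> span {d'}"
proof -
  obtain s where s: "p + 0 *\<^sub>R d = p' + s *\<^sub>R d'"
    using assms by (metis (mono_tags, lifting) rangeE rangeI)
  obtain t where t: "p + 1 *\<^sub>R d = p' + t *\<^sub>R d'"
    using assms by (metis (mono_tags, lifting) rangeE rangeI)
  have "d = (t - s) *\<^sub>R d'"
    using s t by (simp add: algebra_simps)
  then show ?thesis
    by (simp add: span_base span_scale)
qed

lemma line_neq_sphere:
  fixes p d z :: "'a::real_normed_vector"
  assumes "d \<noteq> 0"
  shows "range (\<lambda>s. p + s *\<^sub>R d) \<noteq> sphere z r"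
proof
  assume eq: "range (\<lambda>s. p + s *\<^sub>R d) = sphere z r"
  \<comment> \<open>Far enough along the line to leave the sphere: \<open>s *\<^sub>R d\<close> is
    longer than \<open>norm (p - z) + \<bar>r\<bar>\<close>.\<close>
  define s where "s = (norm (p - z) + \<bar>r\<bar> + 1) / norm d"
  have "p + s *\<^sub>R d \<in> sphere z r"
    using eq by blast
  then have "norm ((p - z) + s *\<^sub>R d) = r"
    by (simp add: dist_norm norm_minus_commute[of z] add_diff_eq diff_add_eq)
  moreover have "norm (s *\<^sub>R d) = norm (p - z) + \<bar>r\<bar> + 1"
    using assms by (simp add: s_def)
  ultimately show False
    using norm_triangle_ineq4[of "(p - z) + s *\<^sub>R d" "p - z"]
    by simp
qed

lemma sphere_eq_imp_center_eq:
  fixes z z' :: "'a::real_inner"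
  assumes eq: "sphere z r = sphere z' r'" and r: "r > 0"
  shows "z = z'"
proof (rule ccontr)
  assume "z \<noteq> z'"
  \<comment> \<open>The ends \<open>z + e\<close> and \<open>z - e\<close> of this diameter are
    equidistant from \<open>z'\<close>, so \<open>z - z'\<close> would be perpendicular to its own
    multiple \<open>e\<close>.\<close>
  define e where "e = (r / norm (z - z')) *\<^sub>R (z - z')"
  have "norm e = r"
    using \<open>z \<noteq> z'\<close> r by (simp add: e_def)
  then have "z + e \<in> sphere z r" "z - e \<in> sphere z r"
    by (simp_all add: dist_norm)
  then have "norm ((z - z') + e) = norm ((z - z') - e)"
    unfolding eq by (simp add: dist_norm norm_minus_commute algebra_simps)
  then have "(z - z') \<bullet> e = 0"
    by (simp add: norm_eq inner_add inner_diff inner_commute)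
  then show False
    using \<open>z \<noteq> z'\<close> r by (simp add: e_def)
qed

lemma tangent_vectors_line:
  assumes "d \<noteq> 0" "P \<in> range (\<lambda>s. p + s *\<^sub>R d)"
  shows "tangent_vectors (range (\<lambda>s. p + s *\<^sub>R d)) P = span {d}"
proof -
  have "span {d'} = span {d}" if "range (\<lambda>s. p + s *\<^sub>R d) = range (\<lambda>s. p' + s *\<^sub>R d')" for p' d'
    using line_eq_imp_span_eq[OF that] line_eq_imp_span_eq[OF that[symmetric]]
    by (simp add: span_eq)
  then show ?thesis
    using assms line_neq_sphere[OF assms(1)] unfolding tangent_vectors_def by blast
qed

lemma tangent_vectors_sphere:
  assumes "r > 0" "P \<in> sphere z r"
  shows "tangent_vectors (sphere z r) P = {t. t \<bullet> (P - z) = 0}"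
proof -
  have "z' = z" if "sphere z r = sphere z' r'" for z' r'
    using sphere_eq_imp_center_eq[OF that assms(1)] by simp
  moreover have "sphere z r \<noteq> range (\<lambda>s. p + s *\<^sub>R d)" if "d \<noteq> 0" for p d
    using line_neq_sphere[OF that] by metis
  ultimately show ?thesis
    using assms unfolding tangent_vectors_def by blast
qed

section \<open>Hyperbolic lines as zero sets of spacelike vectors\<close>

definition euclid_carrier :: "real^3 \<Rightarrow> (real^2) set" where
  "euclid_carrier p = {X. p \<bullet> lift X = 0}"

definition hline :: "real^3 \<Rightarrow> (real^2) set" where
  "hline p = euclid_carrier p \<inter> half_plane"

text \<open>The gradient at \<open>X\<close> of the cycle with coefficients
  \<open>p\<close>.\<close>

definition normal_at :: "real^3 \<Rightarrow> real^2 \<Rightarrow> real^2" where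
  "normal_at p X = vector [2 * p$1 * X$1 + p$2, 2 * p$1 * X$2]"

lemma normal_at_nth [simp]:
  "normal_at p X $ 1 = 2 * p$1 * X$1 + p$2" "normal_at p X $ 2 = 2 * p$1 * X$2"
  by (simp_all add: normal_at_def)

lemma in_hline: "X \<in> hline p \<longleftrightarrow> X \<in> half_plane \<and> p \<bullet> lift X = 0"
  by (auto simp: hline_def euclid_carrier_def)

lemma hline_scale: "k \<noteq> 0 \<Longrightarrow> hline (k *\<^sub>R p) = hline p"
  by (auto simp: in_hline)

text \<open>The two sides differ by a combination of the values of both cycles at \<open>X\<close>.
  Hence the Euclidean orthogonality condition is the same at every intersection point.\<close>

lemma inner_normal_at:
  assumes "p \<bullet> lift X = 0" "q \<bullet> lift X = 0"
  shows "normal_at p X \<bullet> normal_at q X = pairing p q"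
proof -
  have "normal_at p X \<bullet> normal_at q X =
      pairing p q + 2 * p$1 * (q \<bullet> lift X) + 2 * q$1 * (p \<bullet> lift X)"
    by (simp add: inner_2 inner_3 pairing_def power2_eq_square algebra_simps)
  with assms show ?thesis by simp
qed

lemma mem_sphere_2:
  fixes X z :: "real^2"
  assumes "r > 0"
  shows "X \<in> sphere z r \<longleftrightarrow> (X$1 - z$1)\<^sup>2 + (X$2 - z$2)\<^sup>2 = r\<^sup>2"
proof -
  have "X \<in> sphere z r \<longleftrightarrow> (norm (X - z))\<^sup>2 = r\<^sup>2"
    using assms by (auto simp: dist_norm norm_minus_commute power2_eq_iff_nonneg)
  also have "(norm (X - z))\<^sup>2 = (X$1 - z$1)\<^sup>2 + (X$2 - z$2)\<^sup>2"
    unfolding power2_norm_eq_inner inner_2 by (simp add: power2_eq_square)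
  finally show ?thesis .
qed

lemma vertical_line_eq:
  fixes p d :: "real^2"
  assumes "d$1 = 0" "d$2 \<noteq> 0"
  shows "range (\<lambda>s. p + s *\<^sub>R d) = {X. X$1 = p$1}"
proof -
  have "X = p + ((X$2 - p$2) / d$2) *\<^sub>R d" if "X$1 = p$1" for X
    using assms that by (simp add: vec_eq_2)
  with assms show ?thesis by auto
qed

lemma spacelike_vertical:
  assumes "pairing p p > 0" "p$1 = 0"
  shows "p$2 \<noteq> 0" "euclid_carrier p = {X. X$1 = - p$3 / p$2}"
    "euclid_carrier p = range (\<lambda>s. vector [- p$3 / p$2, 0] + s *\<^sub>R axis 2 1)"
proof -
  show "p$2 \<noteq> 0"
    using assms by (auto simp: pairing_def)
  then show eq: "euclid_carrier p = {X. X$1 = - p$3 / p$2}"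
    using assms by (auto simp: euclid_carrier_def inner_3 field_simps)
  show "euclid_carrier p = range (\<lambda>s. vector [- p$3 / p$2, 0] + s *\<^sub>R axis 2 1)"
    unfolding eq by (subst vertical_line_eq) (auto simp: axis_def)
qed

lemma spacelike_circle:
  assumes "pairing p p > 0" "p$1 \<noteq> 0"
  shows "sqrt (pairing p p) / (2 * \<bar>p$1\<bar>) > 0"
    "euclid_carrier p = sphere (vector [- p$2 / (2 * p$1), 0]) (sqrt (pairing p p) / (2 * \<bar>p$1\<bar>))"
proof -
  show r: "sqrt (pairing p p) / (2 * \<bar>p$1\<bar>) > 0"
    using assms by simp
  have "X \<in> euclid_carrier p \<longleftrightarrow>
      X \<in> sphere (vector [- p$2 / (2 * p$1), 0]) (sqrt (pairing p p) / (2 * \<bar>p$1\<bar>))" for X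
  proof -
    have "(X$1 - (- p$2 / (2 * p$1)))\<^sup>2 + (X$2 - 0)\<^sup>2 - pairing p p / (2 * p$1)\<^sup>2 =
        (p \<bullet> lift X) / p$1"
      using assms(2) by (simp add: pairing_def inner_3 field_simps power2_eq_square)
    moreover have "(sqrt (pairing p p) / (2 * \<bar>p$1\<bar>))\<^sup>2 = pairing p p / (2 * p$1)\<^sup>2"
      using assms(1) by (simp add: power_divide power_mult_distrib)
    ultimately show ?thesis
      using assms(2) unfolding mem_sphere_2[OF r] euclid_carrier_def by auto
  qed
  then show "euclid_carrier p =
      sphere (vector [- p$2 / (2 * p$1), 0]) (sqrt (pairing p p) / (2 * \<bar>p$1\<bar>))"
    by blast
qed

lemma euclid_carrier_line_or_circle:
  assumes "pairing p p > 0"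
  shows "euclid_line (euclid_carrier p) \<or> euclid_circle (euclid_carrier p)"
proof (cases "p$1 = 0")
  case True
  then show ?thesis
    unfolding euclid_line_def using spacelike_vertical(3)[OF assms] by (metis axis_eq_0_iff zero_neq_one)
next
  case False
  then show ?thesis
    unfolding euclid_circle_def using spacelike_circle[OF assms] by blast
qed

lemma tangent_vectors_euclid_carrier:
  assumes "pairing p p > 0" "P \<in> euclid_carrier p"
  shows "tangent_vectors (euclid_carrier p) P = {t. t \<bullet> normal_at p P = 0}"
proof (cases "p$1 = 0")
  case True
  have "tangent_vectors (euclid_carrier p) P = span {axis 2 1}"
    using tangent_vectors_line assms spacelike_vertical(3)[OF assms(1) True]
    by (metis axis_eq_0_iff zero_neq_one)
  also have "\<dots> = {t. t$1 = 0}"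
  proof -
    have "t = t$2 *\<^sub>R axis 2 1" if "t$1 = 0" for t :: "real^2"
      using that by (simp add: vec_eq_2 axis_def)
    then show ?thesis
      by (auto simp: span_singleton axis_def)
  qed
  also have "\<dots> = {t. t \<bullet> normal_at p P = 0}"
    using True spacelike_vertical(1)[OF assms(1) True] by (auto simp: inner_2)
  finally show ?thesis .
next
  case False
  let ?z = "vector [- p$2 / (2 * p$1), 0] :: real^2"
  have "tangent_vectors (euclid_carrier p) P = {t. t \<bullet> (P - ?z) = 0}"
    using tangent_vectors_sphere assms(2) spacelike_circle[OF assms(1) False] by metis
  moreover have "normal_at p P = (2 * p$1) *\<^sub>R (P - ?z)"
    using False by (simp add: vec_eq_2 field_simps)
  ultimately show ?thesis
    using False by simp
qed

lemma normal_at_nonzero: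
  assumes "pairing p p > 0" "p \<bullet> lift X = 0"
  shows "normal_at p X \<noteq> 0"
  using inner_normal_at[OF assms(2) assms(2)] assms(1) by auto

text \<open>A quarter turn takes normals to tangents and preserves the dot product, so tangents may
  be replaced by normals.\<close>

lemma orthogonal_complements_2:
  fixes a b :: "real^2"
  assumes "a \<noteq> 0" "b \<noteq> 0"
  shows "(\<forall>s t. s \<bullet> a = 0 \<longrightarrow> t \<bullet> b = 0 \<longrightarrow> s \<bullet> t = 0) \<longleftrightarrow> a \<bullet> b = 0"
proof
  assume *: "\<forall>s t. s \<bullet> a = 0 \<longrightarrow> t \<bullet> b = 0 \<longrightarrow> s \<bullet> t = 0"
  show "a \<bullet> b = 0"
    using *[rule_format, of "vector [- a$2, a$1]" "vector [- b$2, b$1]"] by (simp add: inner_2)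
next
  assume ab: "a \<bullet> b = 0"
  have "s \<bullet> t = 0" if "s \<bullet> a = 0" "t \<bullet> b = 0" for s t
  proof -
    have "(a \<bullet> a) * (b \<bullet> b) * (s \<bullet> t) = 0"
      using ab that unfolding inner_2 by algebra
    with assms show ?thesis by simp
  qed
  then show "\<forall>s t. s \<bullet> a = 0 \<longrightarrow> t \<bullet> b = 0 \<longrightarrow> s \<bullet> t = 0"
    by blast
qed

lemma x_axis_eq: "x_axis = range (\<lambda>s. 0 + s *\<^sub>R axis 1 1)"
proof -
  have "X = 0 + X$1 *\<^sub>R axis 1 1" if "X$2 = 0" for X :: "real^2"
    using that by (simp add: vec_eq_2 axis_def)
  then show ?thesis
    unfolding x_axis_def by (auto simp: axis_def)
qed

lemma euclid_line_x_axis: "euclid_line x_axis"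
  unfolding euclid_line_def x_axis_eq by (metis axis_eq_0_iff zero_neq_one)

lemma tangent_vectors_x_axis:
  assumes "P \<in> x_axis"
  shows "tangent_vectors x_axis P = {t. t$2 = 0}"
proof -
  have "tangent_vectors x_axis P = span {axis 1 1}"
    using assms tangent_vectors_line unfolding x_axis_eq by (metis axis_eq_0_iff zero_neq_one)
  also have "\<dots> = x_axis"
    unfolding x_axis_eq by (auto simp: span_singleton)
  finally show ?thesis
    by (simp add: x_axis_def)
qed

text \<open>At an intersection with the axis all tangents are vertical. So a line is vertical, and a
  circle has a horizontal radius there, hence its center on the axis.\<close>

lemma orthogonal_x_axis_imp_euclid_carrier:
  assumes "euclid_orthogonal C x_axis"
  shows "\<exists>p. pairing p p > 0 \<and> C = euclid_carrier p"
proof -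
  obtain P where P: "P \<in> C" "P \<in> x_axis"
    using assms by (auto simp: euclid_orthogonal_def)
  have "axis 1 1 \<in> tangent_vectors x_axis P"
    using tangent_vectors_x_axis[OF P(2)] by (simp add: axis_def)
  then have vert: "t$1 = 0" if "t \<in> tangent_vectors C P" for t
    using assms P that by (force simp: euclid_orthogonal_def inner_2 axis_def)
  consider "euclid_line C" | "euclid_circle C"
    using assms by (auto simp: euclid_orthogonal_def)
  then show ?thesis
  proof cases
    case 1
    then obtain p d where d: "d \<noteq> 0" and C: "C = range (\<lambda>s. p + s *\<^sub>R d)"
      by (auto simp: euclid_line_def)
    have "tangent_vectors C P = span {d}"
      using tangent_vectors_line[OF d] P(1) C by simp
    then have "d$1 = 0"
      using vert by (simp add: span_base)
    with d have "d$2 \<noteq> 0"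
      by (simp add: vec_eq_2)
    then have "C = euclid_carrier (vector [0, 1, - p$1])"
      using \<open>d$1 = 0\<close> unfolding C by (simp add: vertical_line_eq euclid_carrier_def inner_3)
    then show ?thesis
      by (intro exI[of _ "vector [0, 1, - p$1]"]) (simp add: pairing_def)
  next
    case 2
    then obtain z r where r: "r > 0" and C: "C = sphere z r"
      by (auto simp: euclid_circle_def)
    have "tangent_vectors C P = {t. t \<bullet> (P - z) = 0}"
      using tangent_vectors_sphere[OF r] P(1) C by simp
    \<comment> \<open>The radius at \<open>P\<close> after a quarter turn is tangent, hence
      vertical.\<close>
    then have "(vector [- (P - z)$2, (P - z)$1] :: real^2) \<in> tangent_vectors C P"
      by (simp add: inner_2 algebra_simps)
    then have "P$2 = z$2"
      using vert by fastforce
    then have z: "z$2 = 0"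
      using P(2) by (simp add: x_axis_def)
    let ?p = "vector [1, - 2 * z$1, (z$1)\<^sup>2 - r\<^sup>2] :: real^3"
    have "C = euclid_carrier ?p"
      unfolding C set_eq_iff mem_sphere_2[OF r]
      using z by (auto simp: euclid_carrier_def inner_3 power2_eq_square algebra_simps)
    moreover have "pairing ?p ?p > 0"
      using r by (simp add: pairing_def power2_eq_square)
    ultimately show ?thesis by blast
  qed
qed

lemma euclid_carrier_orthogonal_x_axis:
  assumes "pairing p p > 0"
  shows "euclid_orthogonal (euclid_carrier p) x_axis"
proof -
  \<comment> \<open>Orthogonality includes meeting the axis. On the axis the cycle is a polynomial
    in \<open>x\<close> of degree at most two, and \<open>pairing p p\<close> is its discriminant
    when \<open>p$1\<close> is nonzero.\<close>
  have "\<exists>x. p$1 * x\<^sup>2 + p$2 * x + p$3 = 0"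
  proof (cases "p$1 = 0")
    case True
    then show ?thesis
      using spacelike_vertical(1)[OF assms] by (intro exI[of _ "- p$3 / p$2"]) simp
  next
    case False
    have "discrim (p$1) (p$2) (p$3) \<ge> 0"
      using assms by (simp add: discrim_def pairing_def power2_eq_square)
    with False show ?thesis
      using discriminant_nonneg by blast
  qed
  then obtain x where "vector [x, 0] \<in> euclid_carrier p \<inter> x_axis"
    by (auto simp: euclid_carrier_def inner_3 x_axis_def algebra_simps)
  moreover have "s \<bullet> t = 0" if P: "P \<in> euclid_carrier p" "P \<in> x_axis"
    and s: "s \<in> tangent_vectors (euclid_carrier p) P" and t: "t \<in> tangent_vectors x_axis P" for P s t
  proof -
    have "normal_at p P \<noteq> 0"
      using normal_at_nonzero[OF assms] P(1) by (simp add: euclid_carrier_def)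
    moreover have "normal_at p P $ 2 = 0"
      using P(2) by (simp add: x_axis_def)
    ultimately have "normal_at p P $ 1 \<noteq> 0"
      by (auto simp: vec_eq_2 simp del: normal_at_nth)
    moreover have "s$1 * normal_at p P $ 1 = 0"
      using s \<open>normal_at p P $ 2 = 0\<close>
      unfolding tangent_vectors_euclid_carrier[OF assms P(1)] by (simp add: inner_2 del: normal_at_nth)
    ultimately have "s$1 = 0"
      by simp
    moreover have "t$2 = 0"
      using t tangent_vectors_x_axis[OF P(2)] by simp
    ultimately show ?thesis
      by (simp add: inner_2)
  qed
  ultimately show ?thesis
    using euclid_carrier_line_or_circle[OF assms] euclid_line_x_axis
    unfolding euclid_orthogonal_def by blast
qed

lemma carrier_of_iff:
  "carrier_of L C \<longleftrightarrow> (\<exists>p. pairing p p > 0 \<and> C = euclid_carrier p \<and> L = hline p)"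
  unfolding carrier_of_def hline_def
  using orthogonal_x_axis_imp_euclid_carrier euclid_carrier_orthogonal_x_axis by blast

lemma hyp_line_iff: "hyp_line L \<longleftrightarrow> (\<exists>p. pairing p p > 0 \<and> L = hline p)"
  unfolding hyp_line_def carrier_of_iff by blast

section \<open>Recovering the vector of a hyperbolic line up to scale\<close>

lemma hline_two_points:
  assumes "pairing p p > 0"
  shows "\<exists>X Y. X \<in> hline p \<and> Y \<in> hline p \<and> X \<noteq> Y"
proof (cases "p$1 = 0")
  case True
  then have "vector [- p$3 / p$2, 1] \<in> hline p" "vector [- p$3 / p$2, 2] \<in> hline p"
    using spacelike_vertical(2)[OF assms True] by (auto simp: hline_def half_plane_def)
  moreover have "vector [- p$3 / p$2, 1] \<noteq> (vector [- p$3 / p$2, 2] :: real^2)"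
    by (simp add: vec_eq_2)
  ultimately show ?thesis by blast
next
  case False
  define z where "z = - p$2 / (2 * p$1)"
  define r where "r = sqrt (pairing p p) / (2 * \<bar>p$1\<bar>)"
  have r: "r > 0" and S: "euclid_carrier p = sphere (vector [z, 0]) r"
    using spacelike_circle[OF assms False] by (simp_all add: z_def r_def)
  \<comment> \<open>The top of the semicircle and a point given by the 3-4-5 right triangle.\<close>
  have "vector [z, r] \<in> hline p" "vector [z + 3 / 5 * r, 4 / 5 * r] \<in> hline p"
    using r unfolding hline_def S Int_iff mem_sphere_2[OF r]
    by (simp_all add: half_plane_def power2_eq_square)
  moreover have "vector [z, r] \<noteq> (vector [z + 3 / 5 * r, 4 / 5 * r] :: real^2)"
    using r by (simp add: vec_eq_2)
  ultimately show ?thesis by blast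
qed

lemma scaled_if_common_points:
  assumes "X \<in> half_plane" "Y \<in> half_plane" "X \<noteq> Y"
    and "p \<bullet> lift X = 0" "p \<bullet> lift Y = 0" "q \<bullet> lift X = 0" "q \<bullet> lift Y = 0" "p \<noteq> 0"
  shows "\<exists>k. q = k *\<^sub>R p"
  using orthogonal_both_unique[OF lift_cross_nonzero] assms by blast

lemma scaled_if_vanishes_on_hline:
  assumes "pairing p p > 0" "\<And>X. X \<in> hline p \<Longrightarrow> q \<bullet> lift X = 0"
  shows "\<exists>k. q = k *\<^sub>R p"
proof -
  obtain X Y where XY: "X \<in> hline p" "Y \<in> hline p" "X \<noteq> Y"
    using hline_two_points[OF assms(1)] by blast
  moreover have "p \<noteq> 0"
    using assms(1) by (auto simp: pairing_def)
  ultimately show ?thesis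
    using scaled_if_common_points[of X Y p q] assms(2) by (simp add: in_hline)
qed

lemma hline_eq_imp_scaled:
  assumes "pairing p p > 0" "pairing q q > 0" "hline p = hline q"
  shows "\<exists>k. k \<noteq> 0 \<and> q = k *\<^sub>R p"
proof -
  obtain k where "q = k *\<^sub>R p"
    using scaled_if_vanishes_on_hline[OF assms(1)] assms(3) by (auto simp: in_hline)
  moreover from this have "k \<noteq> 0"
    using assms(2) by auto
  ultimately show ?thesis by blast
qed

text \<open>Vectors of the same hyperbolic line are proportional and so share their zero set. This
  resolves the existential carriers in orthogonality and in boundary incidence.\<close>

lemma carrier_of_hline:
  assumes "pairing p p > 0"
  shows "carrier_of (hline p) C \<longleftrightarrow> C = euclid_carrier p"
proof
  assume "carrier_of (hline p) C"
  then obtain q where q: "pairing q q > 0" "C = euclid_carrier q" "hline p = hline q"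
    by (auto simp: carrier_of_iff)
  then obtain k where "k \<noteq> 0" "q = k *\<^sub>R p"
    using hline_eq_imp_scaled[OF assms] by blast
  with q(2) show "C = euclid_carrier p"
    by (simp add: euclid_carrier_def)
qed (use assms in \<open>auto simp: carrier_of_iff\<close>)

lemma euclid_orthogonal_carriers_iff:
  assumes p: "pairing p p > 0" and q: "pairing q q > 0"
  shows "euclid_orthogonal (euclid_carrier p) (euclid_carrier q) \<longleftrightarrow> pairing p q = 0"
proof -
  have at_point: "(\<forall>s\<in>tangent_vectors (euclid_carrier p) P.
      \<forall>t\<in>tangent_vectors (euclid_carrier q) P. s \<bullet> t = 0) \<longleftrightarrow> pairing p q = 0" if "P \<in> euclid_carrier p" "P \<in> euclid_carrier q" for P
    using orthogonal_complements_2[of "normal_at p P" "normal_at q P"] that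
      normal_at_nonzero[OF p] normal_at_nonzero[OF q] inner_normal_at[of p P q]
    unfolding tangent_vectors_euclid_carrier[OF p that(1)] tangent_vectors_euclid_carrier[OF q that(2)]
    by (simp add: euclid_carrier_def)
  \<comment> \<open>Orthogonality also demands an intersection. With zero pairing the Gram
    determinant is a product of positive numbers, so the carriers meet.\<close>
  have meet: "euclid_carrier p \<inter> euclid_carrier q \<noteq> {}" if "pairing p q = 0"
  proof -
    have gram: "pairing p p * pairing q q - (pairing p q)\<^sup>2 > 0"
      using p q that by simp
    then have "p \<times> q \<noteq> 0"
      unfolding gram_eq_cross by auto
    then show ?thesis
      using common_point_iff_gram_pos gram by (auto simp: euclid_carrier_def)
  qed
  show ?thesis
    using at_point meet euclid_carrier_line_or_circle[OF p] euclid_carrier_line_or_circle[OF q]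
    unfolding euclid_orthogonal_def by blast
qed

lemma hyp_orthogonal_hline_iff:
  assumes "pairing p p > 0" "pairing q q > 0"
  shows "hyp_orthogonal (hline p) (hline q) \<longleftrightarrow> pairing p q = 0"
  unfolding hyp_orthogonal_def
  by (simp add: carrier_of_hline assms euclid_orthogonal_carriers_iff)

lemma boundary_on_axis_point_iff:
  assumes "pairing p p > 0"
  shows "boundary_on (Axis_Point x) (hline p) \<longleftrightarrow> p \<bullet> lift (vector [x, 0]) = 0"
  using assms by (simp add: carrier_of_hline euclid_carrier_def)

lemma boundary_on_infinity_iff:
  assumes "pairing p p > 0"
  shows "boundary_on Infinity_Point (hline p) \<longleftrightarrow> p$1 = 0"
proof
  assume "boundary_on Infinity_Point (hline p)"
  then obtain x where "hline p = {X. X$1 = x} \<inter> half_plane"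
    by auto
  also have "\<dots> = hline (vector [0, 1, - x])"
    by (auto simp: in_hline inner_3)
  finally have "hline (vector [0, 1, - x]) = hline p" ..
  moreover have "pairing (vector [0, 1, - x]) (vector [0, 1, - x]) > 0"
    by (simp add: pairing_def)
  ultimately obtain k where "p = k *\<^sub>R vector [0, 1, - x]"
    using hline_eq_imp_scaled assms by blast
  then show "p$1 = 0"
    by simp
next
  assume "p$1 = 0"
  then show "boundary_on Infinity_Point (hline p)"
    using spacelike_vertical(2)[OF assms] by (auto simp: hline_def)
qed

section \<open>Defining cycles, sides and altitudes as vectors\<close>

lemma defines_lineE:
  assumes "defines_line f L"
  obtains p where "f = axis_cycle p" "pairing p p > 0" "L = hline p"
proof -
  obtain a b c where f: "f = quad_fun a b c" and nz: "f \<noteq> (\<lambda>X. 0)"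
    using assms by (auto simp: defines_line_def is_cycle_def quad_space_def)
  obtain p where p: "pairing p p > 0" "{X. f X = 0} = euclid_carrier p" and L: "L = hline p"
    using assms by (auto simp: defines_line_def carrier_of_iff)
  obtain X where X: "X \<in> hline p"
    using hline_two_points[OF p(1)] by blast
  \<comment> \<open>The zero set contains the mirror image of \<open>X\<close> too; subtracting the
    two equations isolates the coefficient of \<open>y\<close>.\<close>
  let ?X' = "vector [X$1, - X$2] :: real^2"
  have "X \<in> euclid_carrier p" "?X' \<in> euclid_carrier p"
    using X by (simp_all add: euclid_carrier_def in_hline inner_3)
  then have "f X = 0" "f ?X' = 0"
    unfolding p(2)[symmetric] by simp_all
  then have "b$2 * X$2 = 0"
    unfolding f quad_fun_def inner_2 vector_2 mult_minus_left mult_minus_right minus_minus by linarith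
  then have "b$2 = 0"
    using X by (simp add: in_hline half_plane_def)
  \<comment> \<open>The vector must carry the coefficients of \<open>f\<close> itself;
    \<open>p\<close> is only known to have the same zero set.\<close>
  define q :: "real^3" where "q = vector [a, b$1, c]"
  have fq: "f = axis_cycle q"
    using \<open>b$2 = 0\<close> by (simp add: f axis_cycle_def q_def quad_fun_inject vec_eq_2)
  have "euclid_carrier q = euclid_carrier p"
    using p(2) by (simp add: fq axis_cycle_eq_inner euclid_carrier_def)
  then have "L = hline q"
    by (simp add: L hline_def)
  have "q \<bullet> lift X = 0"
    using \<open>f X = 0\<close> by (simp add: fq axis_cycle_eq_inner)
  moreover have "q \<noteq> 0"
    using nz by (auto simp: fq axis_cycle_eq_inner)
  ultimately have "pairing q q > 0"
    using spacelike_if_vanishes X by (auto simp: in_hline)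
  with fq \<open>L = hline q\<close> that show thesis by blast
qed

lemma line_through_eq_hline:
  assumes "X \<in> half_plane" "Y \<in> half_plane" "X \<noteq> Y"
    and "p \<bullet> lift X = 0" "p \<bullet> lift Y = 0" "p \<noteq> 0"
  shows "line_through X Y = hline p"
  unfolding line_through_def
proof (rule the_equality)
  show "hyp_line (hline p) \<and> X \<in> hline p \<and> Y \<in> hline p"
    using assms spacelike_if_vanishes by (auto simp: hyp_line_iff in_hline)
next
  fix L
  assume L: "hyp_line L \<and> X \<in> L \<and> Y \<in> L"
  then obtain q where q: "pairing q q > 0" "L = hline q"
    by (auto simp: hyp_line_iff)
  then obtain k where k: "q = k *\<^sub>R p"
    using scaled_if_common_points[of X Y p q] assms L by (auto simp: in_hline)
  then have "k \<noteq> 0"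
    using q(1) by auto
  then show "L = hline p"
    using k q(2) by (simp add: hline_scale)
qed

lemma in_line_through:
  assumes "X \<in> half_plane" "Y \<in> half_plane" "X \<noteq> Y"
  shows "X \<in> line_through X Y" "Y \<in> line_through X Y"
proof -
  have "line_through X Y = hline (lift X \<times> lift Y)"
    using assms lift_cross_nonzero
    by (intro line_through_eq_hline) (simp_all add: dot_cross_self inner_commute[of _ "lift X"])
  then show "X \<in> line_through X Y" "Y \<in> line_through X Y"
    using assms by (simp_all add: in_hline dot_cross_self inner_commute[of _ "lift X"])
qed

text \<open>Both conditions are perpendicularity in three-space, to the independent vectors
  \<open>lift X\<close> and \<open>polar q\<close>.\<close>

lemma perpendicular_unique:
  assumes "pairing q q > 0"
    and "p \<bullet> lift X = 0" "pairing p q = 0" "p' \<bullet> lift X = 0" "pairing p' q = 0" "p \<noteq> 0"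
  shows "\<exists>k. p' = k *\<^sub>R p"
  using orthogonal_both_unique[OF lift_cross_polar_nonzero[OF assms(1)]] assms(2-)
  unfolding pairing_eq_inner_polar by blast

lemma altitude_eq_hline:
  assumes "X \<in> half_plane" "pairing q q > 0" "p \<bullet> lift X = 0" "pairing p q = 0" "p \<noteq> 0"
  shows "altitude X (hline q) = hline p"
  unfolding altitude_def
proof (rule the_equality)
  have p: "pairing p p > 0"
    using spacelike_if_vanishes assms by blast
  then show "hyp_line (hline p) \<and> X \<in> hline p \<and> hyp_orthogonal (hline p) (hline q)"
    using assms hyp_orthogonal_hline_iff by (auto simp: hyp_line_iff in_hline)
next
  fix K
  assume K: "hyp_line K \<and> X \<in> K \<and> hyp_orthogonal K (hline q)"
  then obtain p' where p': "pairing p' p' > 0" "K = hline p'"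
    by (auto simp: hyp_line_iff)
  then have "p' \<bullet> lift X = 0" "pairing p' q = 0"
    using K assms(2) by (auto simp: in_hline hyp_orthogonal_hline_iff)
  then obtain k where k: "p' = k *\<^sub>R p"
    using perpendicular_unique assms(2-5) by blast
  then have "k \<noteq> 0"
    using p'(1) by auto
  then show "K = hline p"
    using k p'(2) by (simp add: hline_scale)
qed

text \<open>Any two points, even equal ones, lie on a hyperbolic line, so coinciding vertices would
  put all three on one line.\<close>

lemma hyp_triangle_distinct:
  assumes "hyp_triangle u v w"
  shows "u \<noteq> v" "v \<noteq> w" "w \<noteq> u"
proof -
  have H: "u \<in> half_plane" "v \<in> half_plane" "w \<in> half_plane"
    using assms by (auto simp: hyp_triangle_def)
  have line: "\<exists>L. hyp_line L \<and> X \<in> L \<and> Y \<in> L" if "X \<in> half_plane" "Y \<in> half_plane" for X Y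
  proof (cases "X = Y")
    case True
    have "X \<in> hline (vector [0, 1, - X$1])"
      using that by (simp add: in_hline inner_3)
    moreover have "hyp_line (hline (vector [0, 1, - X$1]))"
      unfolding hyp_line_iff by (intro exI[of _ "vector [0, 1, - X$1]"]) (simp add: pairing_def)
    ultimately show ?thesis using True by blast
  next
    case False
    let ?p = "lift X \<times> lift Y"
    have "X \<in> hline ?p" "Y \<in> hline ?p"
      using that by (simp_all add: in_hline dot_cross_self inner_commute[of _ "lift X"])
    moreover have "hyp_line (hline ?p)"
      using spacelike_if_vanishes \<open>X \<in> hline ?p\<close> lift_cross_nonzero[OF that False]
      unfolding hyp_line_iff in_hline by blast
    ultimately show ?thesis by blast
  qed
  show "u \<noteq> v" "v \<noteq> w" "w \<noteq> u"
    using line[OF H(1,3)] line[OF H(1,2)] assms by (auto simp: hyp_triangle_def)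
qed

section \<open>Three dependent spacelike vectors\<close>

text \<open>The vector \<open>p \<times> q\<close> spans the common zeros of \<open>p\<close> and \<open>q\<close>; the sign of the Gram determinant
  decides whether it is the lift of a point, a point at infinity, or dual to a hyperbolic line.\<close>

locale spacelike_pencil =
  fixes p q r :: "real^3"
  assumes independent: "p \<times> q \<noteq> 0" and sum_zero: "r = - (p + q)"
    and spacelike: "pairing p p > 0" "pairing q q > 0" "pairing r r > 0"
begin

definition gram :: real where
  "gram = pairing p p * pairing q q - (pairing p q)\<^sup>2"

lemma gram_eq: "gram = 4 * ((p \<times> q) $ 1 * (p \<times> q) $ 3 - ((p \<times> q) $ 2)\<^sup>2)"
  unfolding gram_def by (rule gram_eq_cross)

lemma gram_pos_iff: "gram > 0 \<longleftrightarrow> (\<exists>P\<in>half_plane. P \<in> hline p \<and> P \<in> hline q \<and> P \<in> hline r)"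
  unfolding gram_def common_point_iff_gram_pos[OF independent, symmetric]
  by (auto simp: in_hline sum_zero inner_diff_left)

lemma gram_zero_iff:
  "gram = 0 \<longleftrightarrow> (\<exists>x. boundary_on x (hline p) \<and> boundary_on x (hline q) \<and> boundary_on x (hline r))"
proof
  let ?c = "p \<times> q"
  assume "gram = 0"
  then have c: "?c$1 * ?c$3 = (?c$2)\<^sup>2"
    by (simp add: gram_eq)
  show "\<exists>x. boundary_on x (hline p) \<and> boundary_on x (hline q) \<and> boundary_on x (hline r)"
  \<comment> \<open>If the last coordinate vanishes, \<open>?c\<close> is a multiple of
    \<open>(1, 0, 0)\<close>, which represents infinity; otherwise it rescales to the lift of a
    point of the axis.\<close>
  proof (cases "?c$3 = 0")
    case True
    then have "?c$2 = 0"
      using c by simp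
    then have "?c$1 \<noteq> 0"
      using independent True unfolding vec_eq_3 by simp
    have "p \<bullet> ?c = 0" "q \<bullet> ?c = 0"
      by (rule dot_cross_self)+
    then have "p$1 = 0" "q$1 = 0"
      using True \<open>?c$2 = 0\<close> \<open>?c$1 \<noteq> 0\<close> by (simp_all add: inner_3)
    then show ?thesis
      using spacelike boundary_on_infinity_iff by (intro exI[of _ Infinity_Point]) (simp add: sum_zero)
  next
    case False
    have "lift (vector [?c$2 / ?c$3, 0]) = (1 / ?c$3) *\<^sub>R ?c"
      using False c by (simp add: vec_eq_3 field_simps power2_eq_square)
    then have "p \<bullet> lift (vector [?c$2 / ?c$3, 0]) = 0" "q \<bullet> lift (vector [?c$2 / ?c$3, 0]) = 0"
      by (simp_all add: dot_cross_self)
    then show ?thesis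
      using spacelike boundary_on_axis_point_iff
      by (intro exI[of _ "Axis_Point (?c$2 / ?c$3)"]) (simp add: sum_zero inner_add_left inner_diff_left)
  qed
next
  assume "\<exists>x. boundary_on x (hline p) \<and> boundary_on x (hline q) \<and> boundary_on x (hline r)"
  then obtain x where x: "boundary_on x (hline p)" "boundary_on x (hline q)"
    by blast
  show "gram = 0"
  proof (cases x)
    case (Axis_Point t)
    then have "lift (vector [t, 0]) \<bullet> p = 0" "lift (vector [t, 0]) \<bullet> q = 0"
      using x spacelike boundary_on_axis_point_iff by (simp_all add: inner_commute)
    then obtain k where k: "lift (vector [t, 0]) = k *\<^sub>R (p \<times> q)"
      using orthogonal_both_imp_scaled_cross[OF independent] by blast
    have c: "k * (p \<times> q)$1 = t\<^sup>2" "k * (p \<times> q)$2 = t" "k * (p \<times> q)$3 = 1"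
      using arg_cong[OF k, of "\<lambda>x. x$1"] arg_cong[OF k, of "\<lambda>x. x$2"] arg_cong[OF k, of "\<lambda>x. x$3"]
      by simp_all
    have "k\<^sup>2 * gram = 4 * ((k * (p \<times> q)$1) * (k * (p \<times> q)$3) - (k * (p \<times> q)$2)\<^sup>2)"
      by (simp add: gram_eq power2_eq_square algebra_simps)
    also have "\<dots> = 0"
      unfolding c by simp
    finally show ?thesis
      using c(3) by auto
  next
    case Infinity_Point
    then have "p$1 = 0" "q$1 = 0"
      using x spacelike boundary_on_infinity_iff by auto
    then show ?thesis
      by (simp add: gram_eq cross_components)
  qed
qed

lemma gram_neg_iff:
  "gram < 0 \<longleftrightarrow> (\<exists>!K. hyp_line K \<and> hyp_orthogonal K (hline p) \<and>
    hyp_orthogonal K (hline q) \<and> hyp_orthogonal K (hline r))"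
proof -
  let ?c = "p \<times> q"
  \<comment> \<open>The preimage of \<open>?c\<close> under \<open>polar\<close>, so that pairing
    with \<open>d\<close> is the dot product with \<open>?c\<close>.\<close>
  define d :: "real^3" where "d = vector [- ?c$3 / 2, ?c$2, - ?c$1 / 2]"
  have polar_d: "polar d = ?c"
    by (simp add: d_def vec_eq_3)
  have d_gram: "pairing d d = - gram / 4"
    by (simp add: d_def pairing_def gram_eq power2_eq_square)
  have scaled: "\<exists>k. e = k *\<^sub>R d" if "pairing e p = 0" "pairing e q = 0" for e
  proof -
    have "polar e \<bullet> p = 0" "polar e \<bullet> q = 0"
      using that pairing_eq_inner_polar by (metis pairing_commute inner_commute)+
    then obtain k where "polar e = k *\<^sub>R polar d"
      using orthogonal_both_imp_scaled_cross[OF independent] polar_d by metis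
    then have "e = k *\<^sub>R d"
      by (simp add: vec_eq_3)
    then show ?thesis ..
  qed
  have d_orth: "pairing d p = 0" "pairing d q = 0"
    using pairing_eq_inner_polar polar_d dot_cross_self by (metis pairing_commute)+
  let ?orth = "\<lambda>K. hyp_line K \<and> hyp_orthogonal K (hline p) \<and>
    hyp_orthogonal K (hline q) \<and> hyp_orthogonal K (hline r)"
  \<comment> \<open>Every common perpendicular equals \<open>hline d\<close>, so existence already
    gives uniqueness, and both amount to \<open>d\<close> being spacelike.\<close>
  have orthD: "pairing d d > 0 \<and> K = hline d" if orth: "?orth K" for K
  proof -
    obtain e where e: "pairing e e > 0" "K = hline e"
      using orth by (auto simp: hyp_line_iff)
    then obtain k where k: "e = k *\<^sub>R d"
      using orth spacelike scaled by (auto simp: hyp_orthogonal_hline_iff)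
    then have "k \<noteq> 0"
      using e(1) by auto
    moreover have "pairing d d > 0"
      using e(1) k by (auto simp: zero_less_mult_iff mult_less_0_iff)
    ultimately show ?thesis
      using e(2) k by (simp add: hline_scale)
  qed
  have "?orth (hline d)" if "pairing d d > 0"
    using that d_orth spacelike by (auto simp: hyp_orthogonal_hline_iff hyp_line_iff sum_zero)
  with orthD have "(\<exists>!K. ?orth K) \<longleftrightarrow> pairing d d > 0"
    by blast
  then show ?thesis
    by (simp add: d_gram)
qed

end

section \<open>The altitudes of a triangle as a spacelike pencil\<close>

theorem mainTheorem2:
  fixes u v w :: "real^2"
    and L M N :: "(real^2) set"
    and l m n Au Av :: "real^2 \<Rightarrow> real"
    and \<Delta> :: real
  assumes "hyp_triangle u v w"
    and "L = line_through v w" and "M = line_through w u" and "N = line_through u v"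
    and "defines_line l L" and "defines_line m M" and "defines_line n N"
    and "Au = (\<lambda>X. cycle_pairing n l * m X - cycle_pairing m l * n X)"
    and "Av = (\<lambda>X. cycle_pairing l m * n X - cycle_pairing n m * l X)"
    and "\<Delta> = det (vector [vector [cycle_pairing Au Au, cycle_pairing Au Av],
                           vector [cycle_pairing Au Av, cycle_pairing Av Av]] :: real^2^2)"
  shows "(\<Delta> > 0 \<longleftrightarrow>
            (\<exists>P \<in> half_plane. P \<in> altitude u L \<and> P \<in> altitude v M \<and> P \<in> altitude w N)) \<and>
         (\<Delta> = 0 \<longleftrightarrow>
            (\<exists>q. boundary_on q (altitude u L) \<and> boundary_on q (altitude v M) \<and>
                 boundary_on q (altitude w N))) \<and>
         (\<Delta> < 0 \<longleftrightarrow>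
            (\<exists>!K. hyp_line K \<and> hyp_orthogonal K (altitude u L) \<and>
                  hyp_orthogonal K (altitude v M) \<and> hyp_orthogonal K (altitude w N)))"
proof -
  have H: "u \<in> half_plane" "v \<in> half_plane" "w \<in> half_plane"
    using assms(1) by (auto simp: hyp_triangle_def)
  note dist = hyp_triangle_distinct[OF assms(1)]
  obtain p where p: "l = axis_cycle p" "pairing p p > 0" "L = hline p"
    using defines_lineE[OF assms(5)] .
  obtain q where q: "m = axis_cycle q" "pairing q q > 0" "M = hline q"
    using defines_lineE[OF assms(6)] .
  obtain r where r: "n = axis_cycle r" "pairing r r > 0" "N = hline r"
    using defines_lineE[OF assms(7)] .
  have zero: "p \<bullet> lift v = 0" "p \<bullet> lift w = 0" "q \<bullet> lift w = 0" "q \<bullet> lift u = 0"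
      "r \<bullet> lift u = 0" "r \<bullet> lift v = 0"
    using in_line_through[OF H(2,3) dist(2)] in_line_through[OF H(3,1) dist(3)]
      in_line_through[OF H(1,2) dist(1)] assms(2-4) p(3) q(3) r(3)
    by (auto simp: in_hline)
  \<comment> \<open>A side through its opposite vertex would contain all three vertices.\<close>
  have nonzero: "p \<bullet> lift u \<noteq> 0" "q \<bullet> lift v \<noteq> 0" "r \<bullet> lift w \<noteq> 0"
    using assms(1) H zero p(2) q(2) r(2) unfolding hyp_triangle_def hyp_line_iff
    by (metis in_hline)+
  define au where "au = pairing r p *\<^sub>R q - pairing q p *\<^sub>R r"
  define av where "av = pairing p q *\<^sub>R r - pairing r q *\<^sub>R p"
  define aw where "aw = pairing q r *\<^sub>R p - pairing p r *\<^sub>R q"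
  have vanish: "au \<bullet> lift u = 0" "av \<bullet> lift v = 0" "aw \<bullet> lift w = 0"
    using zero by (simp_all add: au_def av_def aw_def inner_diff_left)
  have orth: "pairing au p = 0" "pairing av q = 0" "pairing aw r = 0"
    by (simp_all add: au_def av_def aw_def)
  \<comment> \<open>Two sides meeting in \<open>w\<close> cannot both be perpendicular to the third:
    they would be proportional, yet only \<open>p\<close> vanishes at \<open>v\<close>. The next two
    facts are cyclic.\<close>
  have p_q: "\<not> (pairing p r = 0 \<and> pairing q r = 0)"
    using perpendicular_unique[OF r(2), of p w q] zero nonzero by force
  have q_r: "\<not> (pairing q p = 0 \<and> pairing r p = 0)"
    using perpendicular_unique[OF p(2), of q u r] zero nonzero by force
  have r_p: "\<not> (pairing r q = 0 \<and> pairing p q = 0)"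
    using perpendicular_unique[OF q(2), of r v p] zero nonzero by force
  \<comment> \<open>At each of the other two vertices only one term survives, so these values detect
    the coefficients.\<close>
  have at_vertices:
    "au \<bullet> lift v = pairing r p * (q \<bullet> lift v)" "au \<bullet> lift w = - pairing q p * (r \<bullet> lift w)"
    "av \<bullet> lift w = pairing p q * (r \<bullet> lift w)" "av \<bullet> lift u = - pairing r q * (p \<bullet> lift u)"
    "aw \<bullet> lift u = pairing q r * (p \<bullet> lift u)" "aw \<bullet> lift v = - pairing p r * (q \<bullet> lift v)"
    using zero by (simp_all add: au_def av_def aw_def inner_diff_left)
  have nz: "au \<noteq> 0" "av \<noteq> 0" "aw \<noteq> 0"
    using at_vertices nonzero p_q q_r r_p by auto
  have independent: "au \<times> av \<noteq> 0"
  proof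
    assume "au \<times> av = 0"
    then obtain k where k: "au = k *\<^sub>R av"
      using cross_eq_zero_imp_scaled nz(2) by blast
    \<comment> \<open>Proportional altitude vectors would vanish at both \<open>u\<close> and
      \<open>v\<close>, which kills both pairings with \<open>r\<close>.\<close>
    then have "au \<bullet> lift v = 0" "k * (av \<bullet> lift u) = 0"
      using vanish by auto
    moreover have "k \<noteq> 0"
      using k nz(1) by auto
    ultimately have "pairing r p = 0" "pairing r q = 0"
      using at_vertices nonzero by auto
    then show False
      using p_q by (simp add: pairing_commute)
  qed
  interpret spacelike_pencil au av aw
  proof
    show "aw = - (au + av)"
      by (simp add: au_def av_def aw_def pairing_commute[of q p]
          pairing_commute[of r p] pairing_commute[of r q])
    show "pairing au au > 0" "pairing av av > 0" "pairing aw aw > 0"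
      using spacelike_if_vanishes H vanish nz by blast+
  qed (rule independent)
  have alt: "altitude u L = hline au" "altitude v M = hline av" "altitude w N = hline aw"
    unfolding p(3) q(3) r(3)
    using altitude_eq_hline H p(2) q(2) r(2) vanish orth nz by blast+
  have "Au = axis_cycle au" "Av = axis_cycle av"
    unfolding assms(8,9) p(1) q(1) r(1) cycle_pairing_axis_cycle
    by (simp_all add: fun_eq_iff axis_cycle_eq_inner au_def av_def inner_diff_left)
  then have "\<Delta> = gram"
    unfolding assms(10) by (simp add: det_2 cycle_pairing_axis_cycle gram_def power2_eq_square)
  then show ?thesis
    unfolding alt using gram_pos_iff gram_zero_iff gram_neg_iff by simp
qed

end
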